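(* Let $k>0$ be an integer and $n=2k-1$. Then $\mathrm{cat}_{X_{2k-1,k}}\mathrm{Sp}(k)\leq 1$.
   Context: $\mathbb{H}$ denotes the quaternions, $M^*$ the conjugate transpose of a quaternionic matrix $M$. $\mathrm{Sp}(k)$ is the Lie group of matrices $P\in\mathbb{H}^{k\times k}$ with $PP^*=I_k$. For $0<k\leq n$, the quaternionic Stiefel manifold $X_{n,k}$ is the space of matrices $x\in\mathbb{H}^{n\times k}$ with $x^*x=I_k$. The group $\mathrm{Sp}(k)$ is regarded as a subspace of $X_{n,k}$ via the canonical inclusion $\iota_{n,k}\colon \mathrm{Sp}(k)\to X_{n,k}$, $P\mapsto\begin{bmatrix}0\\ P\end{bmatrix}$ (with $0\in\mathbb{H}^{(n-k)\times k}$). For a subspace $A$ of a topological space $X$, the subspace LS-category $\mathrm{cat}_X A$ is the least integer $m\geq 0$ such that there exist $m+1$ open subsets of $X$ whose union contains $A$ and each of which is contractible in $X$ (i.e. its inclusion in $X$ is homotopic to a constant map). *)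

theory Defs
  imports "HOL-Analysis.Analysis" "HOL-Library.Extended_Nat"
begin

section \<open>Quaternions\<close>

datatype quat = Quat (qRe: real) (qI: real) (qJ: real) (qK: real)

lemma quat_eq_iff:
  "p = q \<longleftrightarrow> qRe p = qRe q \<and> qI p = qI q \<and> qJ p = qJ q \<and> qK p = qK q"
  by (cases p; cases q) auto

instantiation quat :: ring_1
begin

definition "0 = Quat 0 0 0 0"
definition "1 = Quat 1 0 0 0"
definition "p + q = Quat (qRe p + qRe q) (qI p + qI q) (qJ p + qJ q) (qK p + qK q)"
definition "- p = Quat (- qRe p) (- qI p) (- qJ p) (- qK p)"
definition "p - q = Quat (qRe p - qRe q) (qI p - qI q) (qJ p - qJ q) (qK p - qK q)"
definition "p * q = Quat
  (qRe p * qRe q - qI p * qI q - qJ p * qJ q - qK p * qK q)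
  (qRe p * qI q + qI p * qRe q + qJ p * qK q - qK p * qJ q)
  (qRe p * qJ q - qI p * qK q + qJ p * qRe q + qK p * qI q)
  (qRe p * qK q + qI p * qJ q - qJ p * qI q + qK p * qRe q)"

lemmas quat_ring_defs = zero_quat_def one_quat_def plus_quat_def uminus_quat_def
  minus_quat_def times_quat_def

instance
  by standard (auto simp: quat_ring_defs quat_eq_iff algebra_simps)

end

instantiation quat :: real_algebra_1
begin

definition "r *\<^sub>R q = Quat (r * qRe q) (r * qI q) (r * qJ q) (r * qK q)"

instance
  by standard (auto simp: scaleR_quat_def quat_ring_defs quat_eq_iff algebra_simps)

end

definition qcnj :: "quat \<Rightarrow> quat"
  where "qcnj q = Quat (qRe q) (- qI q) (- qJ q) (- qK q)"

instantiation quat :: real_inner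
begin

definition "inner p q = qRe p * qRe q + qI p * qI q + qJ p * qJ q + qK p * qK q"
definition "norm q = sqrt (inner q q)" for q :: quat
definition "sgn q = q /\<^sub>R norm q" for q :: quat
definition "dist p q = norm (p - q)" for p q :: quat
definition "(uniformity :: (quat \<times> quat) filter) =
  (INF e\<in>{0<..}. principal {(p, q). dist p q < e})"
definition "open (U :: quat set) \<longleftrightarrow>
  (\<forall>p\<in>U. eventually (\<lambda>(p', q). p' = p \<longrightarrow> q \<in> U) uniformity)"

instance
proof
  fix p q r :: quat and a :: real
  show "inner p q = inner q p" "inner (p + q) r = inner p r + inner q r"
    "inner (a *\<^sub>R p) q = a * inner p q"
    by (auto simp: inner_quat_def quat_ring_defs scaleR_quat_def algebra_simps)
  show "0 \<le> inner p p"
    by (simp add: inner_quat_def)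
  show "inner p p = 0 \<longleftrightarrow> p = 0"
    by (auto simp: inner_quat_def quat_eq_iff zero_quat_def add_nonneg_eq_0_iff)
qed (simp_all add: norm_quat_def sgn_quat_def dist_quat_def uniformity_quat_def open_quat_def)

end

instantiation quat :: real_normed_div_algebra
begin

definition "inverse q = qcnj q /\<^sub>R inner q q" for q :: quat
definition "p div q = p * inverse q" for p q :: quat

instance
proof
  fix p q :: quat
  have "inner (p * q) (p * q) = inner p p * inner q q"
    by (simp add: inner_quat_def times_quat_def algebra_simps)
  then show "norm (p * q) = norm p * norm q"
    by (simp add: norm_quat_def real_sqrt_mult)
  have l: "qcnj p * p = Quat (inner p p) 0 0 0" "p * qcnj p = Quat (inner p p) 0 0 0"
    by (simp_all add: qcnj_def inner_quat_def times_quat_def algebra_simps)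
  show "inverse p * p = 1" "p * inverse p = 1" if "p \<noteq> 0"
    unfolding inverse_quat_def mult_scaleR_left mult_scaleR_right l
    using that by (simp_all add: scaleR_quat_def one_quat_def)
  show "p div q = p * inverse q"
    by (simp add: divide_quat_def)
  show "inverse (0 :: quat) = 0"
    by (simp add: inverse_quat_def qcnj_def scaleR_quat_def zero_quat_def)
qed

end


section \<open>Quaternionic matrices\<close>

text \<open>
  An \<open>m \<times> n\<close> matrix is a function of a row and a column index (counted from 0)
  that vanishes outside \<open>{..<m} \<times> {..<n}\<close>, so that matrices of all sizes, including
  those with no rows, live in one type. On the set of \<open>m \<times> n\<close> matrices the product
  topology of \<^typ>\<open>nat \<Rightarrow> nat \<Rightarrow> quat\<close> induces the usual topology of a
  finite-dimensional real vector space.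
\<close>

type_synonym qmat = "nat \<Rightarrow> nat \<Rightarrow> quat"

definition qmats :: "nat \<Rightarrow> nat \<Rightarrow> qmat set"
  where "qmats m n = {A. \<forall>i j. \<not> (i < m \<and> j < n) \<longrightarrow> A i j = 0}"

definition qmat_mult :: "nat \<Rightarrow> qmat \<Rightarrow> qmat \<Rightarrow> qmat"
  \<comment> \<open>the first argument is the common inner dimension\<close>
  where "qmat_mult l A B = (\<lambda>i j. \<Sum>h<l. A i h * B h j)"

definition qmat_adj :: "qmat \<Rightarrow> qmat"
  where "qmat_adj A = (\<lambda>i j. qcnj (A j i))"

definition qmat_id :: "nat \<Rightarrow> qmat"
  where "qmat_id k = (\<lambda>i j. if i = j \<and> i < k then 1 else 0)"

definition Sp :: "nat \<Rightarrow> qmat set"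
  where "Sp k = {P \<in> qmats k k. qmat_mult k P (qmat_adj P) = qmat_id k}"

definition stiefel :: "nat \<Rightarrow> nat \<Rightarrow> qmat set"
  where "stiefel n k = {x \<in> qmats n k. qmat_mult n (qmat_adj x) x = qmat_id k}"

text \<open>For \<open>k \<le> n\<close>, put \<open>n - k\<close> zero rows on top of a matrix with \<open>k\<close> rows.\<close>

definition stiefel_incl :: "nat \<Rightarrow> nat \<Rightarrow> qmat \<Rightarrow> qmat"
  where "stiefel_incl n k P = (\<lambda>i j. if i < n - k then 0 else P (i - (n - k)) j)"


section \<open>Subspace Lusternik-Schnirelmann category\<close>

definition contractible_within :: "'a topology \<Rightarrow> 'a set \<Rightarrow> bool"
  where "contractible_within X U \<longleftrightarrow>
    (\<exists>c\<in>topspace X. homotopic_with (\<lambda>_. True) (subtopology X U) X (\<lambda>x. x) (\<lambda>_. c))"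

text \<open>The value is \<open>\<infinity>\<close> if there is no finite cover of the required kind.\<close>

definition subspace_cat :: "'a topology \<Rightarrow> 'a set \<Rightarrow> enat"
  where "subspace_cat X A = Inf {enat m | m. \<exists>U :: nat \<Rightarrow> 'a set.
    (\<forall>i\<le>m. openin X (U i) \<and> contractible_within X (U i)) \<and> A \<subseteq> (\<Union>i\<le>m. U i)}"

end

theory Submission
  imports Defs
begin

text \<open>
  Write \<open>X\<close> for the Stiefel manifold of \<open>n \<times> k\<close> matrices with orthonormal columns and fix a base
  frame \<open>C\<close> in \<open>X\<close>. The subset \<open>\<Omega>(C)\<close> of those \<open>x\<close> in \<open>X\<close> for which \<open>x + C\<close> has linearly
  independent columns is open in \<open>X\<close>, and it is contractible in \<open>X\<close> by a straight line: every
  matrix \<open>(1 - t) x + t C\<close> still has independent columns. For if \<open>(1 - t) x c = - t C c\<close>, then,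
  since \<open>x\<close> and \<open>C\<close> preserve the length of \<open>c\<close>, either \<open>c = 0\<close> or \<open>t = 1/2\<close>, and in the latter case
  \<open>(x + C) c = 0\<close>, so that \<open>c = 0\<close> again (\<open>segment_inj_cols\<close>). Gram-Schmidt
  orthonormalisation is a continuous retraction of the matrices with independent columns onto
  \<open>X\<close>, and it pushes the line into \<open>X\<close> (\<open>contractible_cayley_domain\<close>).

  Two such sets cover \<open>Sp(k)\<close> when \<open>n = 2 k - 1\<close>. Let \<open>e = 1\<close> or \<open>e = -1\<close>, and let \<open>C\<close> be the
  diagonal \<open>n \<times> k\<close> matrix with entries \<open>1, ..., 1, e\<close>. The image \<open>y\<close> of a matrix \<open>P\<close> in \<open>Sp(k)\<close>
  has \<open>k - 1\<close> zero rows on top, so that \<open>(y + C) c = 0\<close> forces all coordinates of \<open>c\<close> but the last to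
  vanish; the next row of the relation, which involves the first row of \<open>P\<close>, then kills the last
  one, unless the last entry of that row of \<open>P\<close> is \<open>-e\<close>. This entry cannot be both \<open>1\<close> and \<open>-1\<close>
  (\<open>incl_in_cayley_domain\<close>). That the image of \<open>Sp(k)\<close> lies in \<open>X\<close> amounts to the fact that
  \<open>P P\<^sup>* = I\<close> implies \<open>P\<^sup>* P = I\<close> (\<open>Sp_in_stiefel\<close>).
\<close>

section \<open>Conjugation and the Hermitian product\<close>

lemma qcnj_simps [simp]:
  "qcnj 0 = 0" "qcnj 1 = 1" "qcnj (qcnj p) = p" "qcnj (- p) = - qcnj p"
  "qcnj (p + q) = qcnj p + qcnj q" "qcnj (p - q) = qcnj p - qcnj q"
  "qcnj (p * q) = qcnj q * qcnj p" "qcnj (r *\<^sub>R p) = r *\<^sub>R qcnj p"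
  by (auto simp: qcnj_def quat_ring_defs scaleR_quat_def quat_eq_iff algebra_simps)

lemma qcnj_sum: "qcnj (sum f A) = (\<Sum>i\<in>A. qcnj (f i))"
  by (induction A rule: infinite_finite_induct) auto

lemma qcnj_mult_self: "qcnj q * q = of_real ((norm q)\<^sup>2)"
  by (auto simp: qcnj_def times_quat_def norm_quat_def inner_quat_def of_real_def
      scaleR_quat_def one_quat_def power2_eq_square algebra_simps)

lemma norm_qcnj [simp]: "norm (qcnj q) = norm q"
  by (simp add: norm_quat_def inner_quat_def qcnj_def)

lemma continuous_on_qcnj [continuous_intros]:
  assumes "continuous_on S f"
  shows "continuous_on S (\<lambda>x. qcnj (f x))"
proof -
  have "bounded_linear qcnj"
    by (rule bounded_linear_intro[where K = 1]) auto
  then show ?thesis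
    using assms by (rule bounded_linear.continuous_on)
qed

text \<open>
  Matrices act from the left and the scalars of \<open>H^n\<close> from the right, so the
  Hermitian product is linear in its second argument.
\<close>

definition hprod :: "nat \<Rightarrow> (nat \<Rightarrow> quat) \<Rightarrow> (nat \<Rightarrow> quat) \<Rightarrow> quat"
  where "hprod n u v = (\<Sum>i<n. qcnj (u i) * v i)"

definition sqnorm :: "nat \<Rightarrow> (nat \<Rightarrow> quat) \<Rightarrow> real"
  where "sqnorm n v = (\<Sum>i<n. (norm (v i))\<^sup>2)"

lemma hprod_self: "hprod n v v = of_real (sqnorm n v)"
  by (simp add: hprod_def sqnorm_def qcnj_mult_self)

lemma hprod_swap: "hprod n v u = qcnj (hprod n u v)"
  by (simp add: hprod_def qcnj_sum)

lemma hprod_diff_right: "hprod n u (\<lambda>i. v i - w i) = hprod n u v - hprod n u w"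
  by (simp add: hprod_def algebra_simps sum_subtractf)

lemma hprod_add_right: "hprod n u (\<lambda>i. v i + w i) = hprod n u v + hprod n u w"
  by (simp add: hprod_def algebra_simps sum.distrib)

lemma hprod_mult_right: "hprod n u (\<lambda>i. v i * c) = hprod n u v * c"
  by (simp add: hprod_def sum_distrib_right mult.assoc)

lemma hprod_scaleR_right: "hprod n u (\<lambda>i. r *\<^sub>R v i) = r *\<^sub>R hprod n u v"
  by (simp add: hprod_def scaleR_sum_right)

lemma hprod_sum_right: "hprod n u (\<lambda>i. \<Sum>l\<in>A. v l i) = (\<Sum>l\<in>A. hprod n u (v l))"
  by (simp add: hprod_def sum_distrib_left sum.swap[of _ A])

lemma hprod_zero_right: "(\<And>i. i < n \<Longrightarrow> v i = 0) \<Longrightarrow> hprod n u v = 0"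
  by (simp add: hprod_def)

lemma sqnorm_nonneg: "0 \<le> sqnorm n v"
  by (simp add: sqnorm_def sum_nonneg)

lemma sqnorm_eq_0_iff: "sqnorm n v = 0 \<longleftrightarrow> (\<forall>i<n. v i = 0)"
  by (auto simp: sqnorm_def sum_nonneg_eq_0_iff)

lemma sqnorm_scaleR: "sqnorm n (\<lambda>i. r *\<^sub>R v i) = r\<^sup>2 * sqnorm n v"
  by (simp add: sqnorm_def power_mult_distrib sum_distrib_left)

lemma stiefel_iff:
  "x \<in> stiefel n k \<longleftrightarrow> x \<in> qmats n k \<and>
    (\<forall>h<k. \<forall>l<k. hprod n (\<lambda>i. x i h) (\<lambda>i. x i l) = (if h = l then 1 else 0))"
proof -
  have "hprod n (\<lambda>i. x i h) (\<lambda>i. x i l) = 0" if "x \<in> qmats n k" "\<not> (h < k \<and> l < k)" for h l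
    using that by (auto simp: hprod_def qmats_def)
  then show ?thesis
    by (auto simp: stiefel_def qmat_mult_def qmat_adj_def qmat_id_def fun_eq_iff
        simp flip: hprod_def)
qed

text \<open>
  A matrix with orthonormal columns is an isometry, which is what forces \<open>t = 1/2\<close> in
  \<open>segment_inj_cols\<close> below.
\<close>

lemma sqnorm_stiefel:
  assumes "x \<in> stiefel n k"
  shows "sqnorm n (\<lambda>i. \<Sum>h<k. x i h * c h) = sqnorm k c"
proof -
  have col: "hprod n (\<lambda>i. \<Sum>h<k. x i h * c h) (\<lambda>i. x i l) = qcnj (c l)" if "l < k" for l
  proof -
    have "hprod n (\<lambda>i. x i l) (\<lambda>i. \<Sum>h<k. x i h * c h)
        = (\<Sum>h<k. hprod n (\<lambda>i. x i l) (\<lambda>i. x i h) * c h)"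
      by (simp add: hprod_sum_right hprod_mult_right)
    also have "\<dots> = (\<Sum>h<k. (if l = h then c h else 0))"
      using assms that by (intro sum.cong) (auto simp: stiefel_iff)
    also have "\<dots> = c l"
      using that by simp
    finally show ?thesis
      by (subst hprod_swap) simp
  qed
  have "hprod n (\<lambda>i. \<Sum>h<k. x i h * c h) (\<lambda>i. \<Sum>h<k. x i h * c h) = hprod k c c"
    using col by (simp add: hprod_sum_right hprod_mult_right) (simp add: hprod_def)
  then show ?thesis
    by (simp add: hprod_self)
qed

section \<open>Gram-Schmidt orthonormalisation\<close>

function gs_col :: "nat \<Rightarrow> qmat \<Rightarrow> nat \<Rightarrow> nat \<Rightarrow> quat" where
  "gs_col n M j =
    (let w = (\<lambda>i. M i j - (\<Sum>l<j. gs_col n M l i * hprod n (gs_col n M l) (\<lambda>i. M i j)))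
     in (\<lambda>i. inverse (sqrt (sqnorm n w)) *\<^sub>R w i))"
  by pat_completeness auto
termination
  by (relation "Wellfounded.measure (\<lambda>(n, M, j). j)") auto

declare gs_col.simps [simp del]

definition gs_res :: "nat \<Rightarrow> qmat \<Rightarrow> nat \<Rightarrow> nat \<Rightarrow> quat"
  where "gs_res n M j =
    (\<lambda>i. M i j - (\<Sum>l<j. gs_col n M l i * hprod n (gs_col n M l) (\<lambda>i. M i j)))"

text \<open>
  The matrices on which the process never divides by zero. For them the normalisation in
  \<open>gs_col\<close> is genuine; a vanishing residue would yield a zero column.
\<close>

definition gs_regular :: "nat \<Rightarrow> nat \<Rightarrow> qmat set"
  where "gs_regular n k = {M. \<forall>j<k. sqnorm n (gs_res n M j) \<noteq> 0}"

text \<open>Rows from \<open>n\<close> on are cut off, so that the result is an \<open>n \<times> k\<close> matrix for every input.\<close>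

definition gram_schmidt :: "nat \<Rightarrow> nat \<Rightarrow> qmat \<Rightarrow> qmat"
  where "gram_schmidt n k M = (\<lambda>i j. if i < n \<and> j < k then gs_col n M j i else 0)"

lemma gs_col_eq: "gs_col n M j = (\<lambda>i. inverse (sqrt (sqnorm n (gs_res n M j))) *\<^sub>R gs_res n M j i)"
  by (subst gs_col.simps) (simp add: gs_res_def Let_def)

lemma gs_orthonormal:
  assumes "M \<in> gs_regular n k" "h < k" "l < k"
  shows "hprod n (gs_col n M h) (gs_col n M l) = (if h = l then 1 else 0)"
proof -
  have "\<forall>h<j. \<forall>l<j. hprod n (gs_col n M h) (gs_col n M l) = (if h = l then 1 else 0)"
    if "j \<le> k" for j
    using that
  proof (induction j)
    case (Suc j)
    then have IH: "hprod n (gs_col n M h) (gs_col n M l) = (if h = l then 1 else 0)"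
      if "h < j" "l < j" for h l
      using that by simp
    have "hprod n (gs_col n M h) (gs_res n M j) = 0" if "h < j" for h
    proof -
      have "hprod n (gs_col n M h) (gs_res n M j) = hprod n (gs_col n M h) (\<lambda>i. M i j)
          - (\<Sum>l<j. hprod n (gs_col n M h) (gs_col n M l) * hprod n (gs_col n M l) (\<lambda>i. M i j))"
        by (simp add: gs_res_def hprod_diff_right hprod_sum_right hprod_mult_right)
      also have "(\<Sum>l<j. hprod n (gs_col n M h) (gs_col n M l) * hprod n (gs_col n M l) (\<lambda>i. M i j))
          = (\<Sum>l<j. if h = l then hprod n (gs_col n M l) (\<lambda>i. M i j) else 0)"
        using IH that by (intro sum.cong) auto
      finally show ?thesis
        using that by simp
    qed
    then have "hprod n (gs_col n M h) (gs_col n M j) = 0" if "h < j" for h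
      using that by (subst (2) gs_col_eq) (simp add: hprod_scaleR_right)
    moreover from this have "hprod n (gs_col n M j) (gs_col n M h) = 0" if "h < j" for h
      using that by (subst hprod_swap) simp
    moreover have "hprod n (gs_col n M j) (gs_col n M j) = 1"
    proof -
      have "sqnorm n (gs_res n M j) > 0"
        using assms(1) Suc.prems sqnorm_nonneg[of n "gs_res n M j"]
        by (auto simp: gs_regular_def less_le)
      then have "sqnorm n (gs_col n M j) = 1"
        by (subst gs_col_eq) (simp add: sqnorm_scaleR power_inverse)
      then show ?thesis
        by (simp add: hprod_self)
    qed
    ultimately show ?case
      using IH by (auto simp: less_Suc_eq)
  qed simp
  then show ?thesis
    using assms by blast
qed

lemma gram_schmidt_in_stiefel:
  assumes "M \<in> gs_regular n k"
  shows "gram_schmidt n k M \<in> stiefel n k"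
proof -
  have "hprod n (\<lambda>i. gram_schmidt n k M i h) (\<lambda>i. gram_schmidt n k M i l)
      = hprod n (gs_col n M h) (gs_col n M l)" if "h < k" "l < k" for h l
    unfolding hprod_def using that by (intro sum.cong) (auto simp: gram_schmidt_def)
  moreover have "gram_schmidt n k M \<in> qmats n k"
    by (auto simp: qmats_def gram_schmidt_def)
  ultimately show ?thesis
    by (simp add: stiefel_iff gs_orthonormal[OF assms])
qed

lemma gram_schmidt_stiefel:
  assumes "x \<in> stiefel n k"
  shows "gram_schmidt n k x = x"
proof -
  have on: "hprod n (\<lambda>i. x i h) (\<lambda>i. x i l) = (if h = l then 1 else 0)" if "h < k" "l < k" for h l
    using assms that by (simp add: stiefel_iff)
  have "gs_col n x j = (\<lambda>i. x i j)" if "j < k" for j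
    using that
  proof (induction j rule: less_induct)
    case (less j)
    have "(\<Sum>l<j. gs_col n x l i * hprod n (gs_col n x l) (\<lambda>i. x i j)) = 0" for i
      using less on by (intro sum.neutral) auto
    then have "gs_res n x j = (\<lambda>i. x i j)"
      by (simp add: gs_res_def)
    moreover have "sqnorm n (\<lambda>i. x i j) = 1"
      using on[OF less.prems less.prems] by (simp add: hprod_self)
    ultimately show ?case
      by (simp add: gs_col_eq)
  qed
  then show ?thesis
    using assms by (auto simp: gram_schmidt_def fun_eq_iff stiefel_iff qmats_def)
qed

text \<open>
  Linear independence of the first \<open>k\<close> columns, truncated to \<open>n\<close> rows, over the quaternions acting
  from the right.
\<close>

definition inj_cols :: "nat \<Rightarrow> nat \<Rightarrow> qmat set"
  where "inj_cols n k =
    {M. \<forall>c. (\<forall>i<n. (\<Sum>l<k. M i l * c l) = 0) \<longrightarrow> (\<forall>l<k. c l = 0)}"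

text \<open>
  Each Gram-Schmidt column is a combination of the original columns up to the same index.
  Allowing all coefficients \<open>c\<close> makes the induction on \<open>j\<close> immediate: unfold the last column and
  absorb its projection part into the coefficients of the earlier ones.
\<close>

lemma gs_span: "\<exists>b. \<forall>i. (\<Sum>l<j. gs_col n M l i * c l) = (\<Sum>l<j. M i l * b l)"
proof (induction j arbitrary: c)
  case (Suc j)
  define a where "a = (\<lambda>l. hprod n (gs_col n M l) (\<lambda>i. M i j))"
  define r where "r = inverse (sqrt (sqnorm n (gs_res n M j)))"
  obtain b where b: "(\<Sum>l<j. gs_col n M l i * (c l - r *\<^sub>R (a l * c j))) = (\<Sum>l<j. M i l * b l)" for i
    using Suc.IH by meson
  have "(\<Sum>l<Suc j. gs_col n M l i * c l) = (\<Sum>l<Suc j. M i l * (b(j := r *\<^sub>R c j)) l)" for i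
  proof -
    have "gs_col n M j i = r *\<^sub>R (M i j - (\<Sum>l<j. gs_col n M l i * a l))"
      by (subst gs_col_eq) (simp add: r_def a_def gs_res_def)
    then have "(\<Sum>l<Suc j. gs_col n M l i * c l)
        = (\<Sum>l<j. gs_col n M l i * (c l - r *\<^sub>R (a l * c j))) + M i j * (r *\<^sub>R c j)"
      by (simp add: right_diff_distrib left_diff_distrib scaleR_diff_right sum_subtractf
          sum_distrib_right scaleR_sum_right mult.assoc)
    then show ?thesis
      by (simp add: b)
  qed
  then show ?case
    by blast
qed simp

text \<open>
  A vanishing residue exhibits a column as a combination of the earlier ones. Conversely, the
  products of the orthonormal columns with the original ones form an upper triangular matrix whose
  diagonal entries are the lengths of the residues; if none of these is zero, a relation between
  the columns can be solved for zero from the last coefficient down.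

  Independence is what the geometric arguments provide; regularity is visibly an open condition on
  which the process is continuous.
\<close>

lemma gs_regular_eq_inj_cols: "gs_regular n k = inj_cols n k"
proof (intro equalityI subsetI)
  fix M assume M: "M \<in> inj_cols n k"
  have "sqnorm n (gs_res n M j) \<noteq> 0" if "j < k" for j
  proof
    assume "sqnorm n (gs_res n M j) = 0"
    then have "M i j = (\<Sum>l<j. gs_col n M l i * hprod n (gs_col n M l) (\<lambda>i. M i j))" if "i < n" for i
      using that by (simp add: sqnorm_eq_0_iff gs_res_def)
    moreover obtain b where "(\<Sum>l<j. gs_col n M l i * hprod n (gs_col n M l) (\<lambda>i. M i j))
        = (\<Sum>l<j. M i l * b l)" for i
      using gs_span[where n = n and M = M and j = j and c = "\<lambda>l. hprod n (gs_col n M l) (\<lambda>i. M i j)"]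
      by blast
    ultimately have b: "M i j = (\<Sum>l<j. M i l * b l)" if "i < n" for i
      using that by simp
    \<comment> \<open>the coefficients of the relation that moves column \<open>j\<close> to the other side\<close>
    define c where "c = (\<lambda>l. if l < j then b l else if l = j then -1 else 0)"
    have "(\<Sum>l<k. M i l * c l) = 0" if "i < n" for i
    proof -
      have "(\<Sum>l<k. M i l * c l) = (\<Sum>l<Suc j. M i l * c l)"
        using \<open>j < k\<close> by (intro sum.mono_neutral_right) (auto simp: c_def)
      also have "\<dots> = 0"
        using b[OF that] by (simp add: c_def)
      finally show ?thesis .
    qed
    then have "c j = 0"
      using M that unfolding inj_cols_def by blast
    then show False
      by (simp add: c_def)
  qed
  then show "M \<in> gs_regular n k"
    by (simp add: gs_regular_def)
next
  fix M assume M: "M \<in> gs_regular n k"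
  have pos: "sqnorm n (gs_res n M j) > 0" if "j < k" for j
    using M that sqnorm_nonneg[of n "gs_res n M j"] by (auto simp: gs_regular_def less_le)
  have col: "M i j = sqrt (sqnorm n (gs_res n M j)) *\<^sub>R gs_col n M j i
      + (\<Sum>l<j. gs_col n M l i * hprod n (gs_col n M l) (\<lambda>i. M i j))" if "j < k" for i j
    using pos[OF that] by (subst gs_col_eq) (simp add: gs_res_def)
  have tri: "hprod n (gs_col n M h) (\<lambda>i. M i j)
      = (if h = j then of_real (sqrt (sqnorm n (gs_res n M j))) else 0)"
    if "j < k" "h < k" "j \<le> h" for h j
  proof -
    have "(\<Sum>l<j. hprod n (gs_col n M h) (gs_col n M l) * hprod n (gs_col n M l) (\<lambda>i. M i j)) = 0"
      using that by (intro sum.neutral) (auto simp: gs_orthonormal[OF M])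
    then have "hprod n (gs_col n M h) (\<lambda>i. sqrt (sqnorm n (gs_res n M j)) *\<^sub>R gs_col n M j i
      + (\<Sum>l<j. gs_col n M l i * hprod n (gs_col n M l) (\<lambda>i. M i j)))
      = (if h = j then of_real (sqrt (sqnorm n (gs_res n M j))) else 0)"
      using that by (simp add: hprod_add_right hprod_sum_right hprod_mult_right
          hprod_scaleR_right gs_orthonormal[OF M] of_real_def)
    then show ?thesis
      by (simp only: col[OF that(1), symmetric])
  qed
  have "\<forall>l<j. c l = 0" if "j \<le> k" "\<forall>i<n. (\<Sum>l<j. M i l * c l) = 0" for j c
    using that
  proof (induction j)
    case (Suc j)
    have "0 = hprod n (gs_col n M j) (\<lambda>i. \<Sum>l<Suc j. M i l * c l)"
      using Suc.prems by (intro hprod_zero_right[symmetric]) blast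
    also have "\<dots> = (\<Sum>l<Suc j. hprod n (gs_col n M j) (\<lambda>i. M i l) * c l)"
      by (simp only: hprod_sum_right hprod_mult_right)
    also have "\<dots> = of_real (sqrt (sqnorm n (gs_res n M j))) * c j"
      using Suc.prems by (simp add: tri)
    finally have "c j = 0"
      using pos[of j] Suc.prems by simp
    then show ?case
      using Suc by (simp add: less_Suc_eq)
  qed simp
  then show "M \<in> inj_cols n k"
    by (auto simp: inj_cols_def)
qed

lemma continuous_on_entry [continuous_intros]:
  "continuous_on S (\<lambda>M :: qmat. M i j)"
proof -
  have "continuous_on S (\<lambda>M :: qmat. M i)"
    using continuous_on_product_then_coordinatewise[OF continuous_on_id[of S]] .
  then show ?thesis
    by (rule continuous_on_product_then_coordinatewise)
qed

lemma continuous_on_hprod [continuous_intros]: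
  assumes "\<And>i. continuous_on S (\<lambda>x. f x i)" "\<And>i. continuous_on S (\<lambda>x. g x i)"
  shows "continuous_on S (\<lambda>x. hprod n (f x) (g x))"
  unfolding hprod_def by (intro continuous_intros assms)

lemma continuous_on_sqnorm [continuous_intros]:
  assumes "\<And>i. continuous_on S (\<lambda>x. f x i)"
  shows "continuous_on S (\<lambda>x. sqnorm n (f x))"
  unfolding sqnorm_def by (intro continuous_intros assms)

lemma continuous_on_gs_res:
  assumes "\<And>l i. l < j \<Longrightarrow> continuous_on S (\<lambda>M. gs_col n M l i)"
  shows "continuous_on S (\<lambda>M. gs_res n M j i)"
  unfolding gs_res_def by (intro continuous_intros assms) auto

lemma continuous_on_gs_col:
  assumes "S \<subseteq> gs_regular n k" "j < k"
  shows "continuous_on S (\<lambda>M. gs_col n M j i)"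
  using assms(2)
proof (induction j arbitrary: i rule: less_induct)
  case (less j)
  have "continuous_on S (\<lambda>M. gs_res n M j i)" for i
    using less by (intro continuous_on_gs_res) auto
  moreover have "\<forall>M\<in>S. sqrt (sqnorm n (gs_res n M j)) \<noteq> 0"
    using assms(1) less.prems by (auto simp: gs_regular_def)
  ultimately show ?case
    by (subst gs_col_eq) (intro continuous_intros, auto)
qed

lemma continuous_on_gram_schmidt: "continuous_on (gs_regular n k) (gram_schmidt n k)"
  unfolding gram_schmidt_def
proof (intro continuous_on_coordinatewise_then_product)
  fix i j
  show "continuous_on (gs_regular n k) (\<lambda>M. if i < n \<and> j < k then gs_col n M j i else 0)"
  proof (cases "i < n \<and> j < k")
    case True
    then show ?thesis
      by (simp add: continuous_on_gs_col[where k = k])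
  qed (simp only: if_False continuous_on_const)
qed

text \<open>
  The residue of column \<open>k\<close> depends continuously on the matrix as long as the first \<open>k\<close> steps do not
  degenerate, so its nonvanishing cuts out an open subset of an open set.
\<close>

lemma open_gs_regular: "open (gs_regular n k)"
proof (induction k)
  case (Suc k)
  have "continuous_on (gs_regular n k) (\<lambda>M. sqnorm n (gs_res n M k))"
    by (intro continuous_intros continuous_on_gs_res continuous_on_gs_col[where k = k]) auto
  then have "open ((\<lambda>M. sqnorm n (gs_res n M k)) -` (- {0}) \<inter> gs_regular n k)"
    using Suc.IH by (subst (asm) continuous_on_open_vimage) auto
  also have "(\<lambda>M. sqnorm n (gs_res n M k)) -` (- {0}) \<inter> gs_regular n k = gs_regular n (Suc k)"
    by (auto simp: gs_regular_def less_Suc_eq)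
  finally show ?case .
qed (simp add: gs_regular_def)

section \<open>Contractible open sets\<close>

text \<open>
  On a relation \<open>c\<close> between the columns of \<open>(1 - t) x + t C\<close>, comparing the lengths of \<open>x c\<close> and
  \<open>C c\<close>, which both equal that of \<open>c\<close>, leaves only the midpoint of the segment to be excluded.
\<close>

lemma segment_inj_cols:
  assumes "x \<in> stiefel n k" "C \<in> stiefel n k"
    and inj: "(\<lambda>i j. x i j + C i j) \<in> inj_cols n k"
    and t: "0 \<le> t" "t \<le> (1::real)"
  shows "(\<lambda>i j. (1 - t) *\<^sub>R x i j + t *\<^sub>R C i j) \<in> inj_cols n k"
proof -
  have "\<forall>l<k. c l = 0"
    if c: "\<forall>i<n. (\<Sum>l<k. ((1 - t) *\<^sub>R x i l + t *\<^sub>R C i l) * c l) = 0" for c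
  proof (rule ccontr)
    assume "\<not> (\<forall>l<k. c l = 0)"
    then have c0: "sqnorm k c \<noteq> 0"
      by (simp add: sqnorm_eq_0_iff)
    define u v where "u = (\<lambda>i. \<Sum>l<k. x i l * c l)" and "v = (\<lambda>i. \<Sum>l<k. C i l * c l)"
    have uv: "(1 - t) *\<^sub>R u i = (- t) *\<^sub>R v i" if "i < n" for i
    proof -
      have "(1 - t) *\<^sub>R u i + t *\<^sub>R v i = 0"
        using c that by (simp add: u_def v_def distrib_right sum.distrib scaleR_sum_right)
      then show ?thesis
        by (simp add: eq_neg_iff_add_eq_0)
    qed
    have "(1 - t)\<^sup>2 * sqnorm n u = sqnorm n (\<lambda>i. (1 - t) *\<^sub>R u i)"
      by (simp only: sqnorm_scaleR)
    also have "\<dots> = sqnorm n (\<lambda>i. (- t) *\<^sub>R v i)"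
      unfolding sqnorm_def using uv by (intro sum.cong) auto
    also have "\<dots> = t\<^sup>2 * sqnorm n v"
      by (simp only: sqnorm_scaleR power2_minus)
    finally have "(1 - t)\<^sup>2 = t\<^sup>2"
      using c0 assms(1,2) by (simp add: u_def v_def sqnorm_stiefel)
    then have half: "t = 1 / 2"
      using t by (simp add: power2_eq_iff_nonneg)
    have "u i + v i = 0" if "i < n" for i
    proof -
      have "(1 / 2 :: real) *\<^sub>R u i = (1 / 2) *\<^sub>R (- v i)"
        using uv[OF that] by (simp add: half)
      then have "u i = - v i"
        by (simp only: scaleR_cancel_left) simp
      then show ?thesis
        by simp
    qed
    then have "\<forall>i<n. (\<Sum>l<k. (x i l + C i l) * c l) = 0"
      by (simp add: u_def v_def distrib_right sum.distrib)
    then show False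
      using inj \<open>\<not> (\<forall>l<k. c l = 0)\<close> by (auto simp: inj_cols_def)
  qed
  then show ?thesis
    by (auto simp: inj_cols_def)
qed

text \<open>
  For \<open>x\<close> and \<open>C\<close> with orthonormal columns this condition says that \<open>I + C\<^sup>* x\<close> is invertible, which
  describes the domain of the Cayley transform centred at \<open>C\<close>: if \<open>C\<^sup>* x c = - c\<close>, then \<open>C\<^sup>*\<close>
  preserves the length of \<open>x c\<close>, hence \<open>x c\<close> lies in the range of \<open>C\<close> and \<open>x c = - C c\<close>.
\<close>

definition cayley_domain :: "nat \<Rightarrow> nat \<Rightarrow> qmat \<Rightarrow> qmat set"
  where "cayley_domain n k C = {x \<in> stiefel n k. (\<lambda>i j. x i j + C i j) \<in> inj_cols n k}"

lemma openin_cayley_domain: "openin (top_of_set (stiefel n k)) (cayley_domain n k C)"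
proof -
  have "continuous_on UNIV (\<lambda>x :: qmat. \<lambda>i j. x i j + C i j)"
    by (intro continuous_on_coordinatewise_then_product continuous_intros)
  then have "open ((\<lambda>x i j. x i j + C i j) -` inj_cols n k)"
    using open_gs_regular[of n k] by (simp add: gs_regular_eq_inj_cols open_vimage)
  then show ?thesis
    unfolding cayley_domain_def openin_open by blast
qed

text \<open>
  The contraction is the straight line to \<open>C\<close> followed by Gram-Schmidt, which fixes both ends
  because they are orthonormal already.
\<close>

lemma contractible_cayley_domain:
  assumes C: "C \<in> stiefel n k"
  shows "contractible_within (top_of_set (stiefel n k)) (cayley_domain n k C)"
proof -
  let ?X = "stiefel n k" and ?U = "cayley_domain n k C"
  define p where "p = (\<lambda>(t::real, x::qmat). \<lambda>i j. (1 - t) *\<^sub>R x i j + t *\<^sub>R C i j)"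
  define H where "H = (\<lambda>z. gram_schmidt n k (p z))"
  have p: "p z \<in> gs_regular n k" if "z \<in> {0..1} \<times> ?U" for z
    using that segment_inj_cols[OF _ C]
    by (auto simp: p_def gs_regular_eq_inj_cols cayley_domain_def)
  have entry: "continuous_on S (\<lambda>z :: real \<times> qmat. snd z i j)" for S i j
    by (rule continuous_on_compose2[OF continuous_on_entry[of UNIV]]) (auto intro: continuous_intros)
  have "continuous_on ({0..1} \<times> ?U) p"
    unfolding p_def case_prod_beta
    by (intro continuous_on_coordinatewise_then_product continuous_intros entry)
  then have H: "continuous_on ({0..1} \<times> ?U) H"
    unfolding H_def using p
    by (intro continuous_on_compose2[OF continuous_on_gram_schmidt]) auto
  have "H (0, x) = x" if "x \<in> ?U" for x
    using that by (simp add: H_def p_def gram_schmidt_stiefel cayley_domain_def)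
  moreover have "H (1, x) = C" for x
    using C by (simp add: H_def p_def gram_schmidt_stiefel)
  moreover have "H ` ({0..1} \<times> ?U) \<subseteq> ?X"
    using p by (auto simp: H_def gram_schmidt_in_stiefel)
  ultimately have hom: "homotopic_with_canon (\<lambda>_. True) ?U ?X (\<lambda>x. x) (\<lambda>_. C)"
    using H by (subst homotopic_with) (auto intro!: exI[of _ H] simp: image_subset_iff_funcset)
  have "?X \<inter> ?U = ?U"
    by (auto simp: cayley_domain_def)
  then have "subtopology (top_of_set ?X) ?U = top_of_set ?U"
    by (simp only: subtopology_subtopology)
  then show ?thesis
    unfolding contractible_within_def using C hom by (intro bexI[of _ C]) (simp_all only: topspace_euclidean_subtopology)
qed

section \<open>Covering the symplectic group\<close>

text \<open>
  A trace computation replaces the dimension count that usually gives \<open>P\<^sup>* P = I\<close> from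
  \<open>P P\<^sup>* = I\<close>. With \<open>G = P\<^sup>* P\<close>, column \<open>j\<close> of \<open>G\<close> is the image of column \<open>j\<close>
  of \<open>P\<close> under the isometry \<open>P\<^sup>*\<close>, so both have the squared length \<open>a j\<close>, which is also the
  diagonal entry of \<open>G\<close>. Hence column \<open>j\<close> of \<open>I - G\<close> has squared length \<open>1 - 2 a j + a j = 1 - a j\<close>.
  The \<open>a j\<close> add up to the sum of all squared entries of \<open>P\<close>, which is \<open>k\<close> because the \<open>k\<close> rows of
  \<open>P\<close> are unit vectors. So the squared lengths of the columns of \<open>I - G\<close> add up to \<open>0\<close>.
\<close>

lemma Sp_in_stiefel:
  assumes "P \<in> Sp k"
  shows "P \<in> stiefel k k"
proof -
  have adj: "qmat_adj P \<in> stiefel k k"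
  proof -
    have "qmat_adj (qmat_adj P) = P"
      by (simp add: qmat_adj_def)
    moreover have "qmat_adj P \<in> qmats k k"
    proof -
      have "P \<in> qmats k k"
        using assms by (simp add: Sp_def)
      then have zero: "P j i = 0" if "\<not> (i < k \<and> j < k)" for i j
        unfolding qmats_def mem_Collect_eq using that by (elim allE[of _ j] allE[of _ i]) iprover
      have "qmat_adj P i j = 0" if "\<not> (i < k \<and> j < k)" for i j
        unfolding qmat_adj_def zero[OF that] by simp
      then show ?thesis
        unfolding qmats_def mem_Collect_eq by iprover
    qed
    ultimately show ?thesis
      using assms by (simp add: Sp_def stiefel_def)
  qed
  define G where "G = (\<lambda>i j. hprod k (\<lambda>h. P h i) (\<lambda>h. P h j))"
  define a where "a = (\<lambda>j. sqnorm k (\<lambda>h. P h j))"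
  define E where "E = (\<lambda>j i. (if i = j then 1 else 0) - G i j)"
  have Gjj: "G j j = of_real (a j)" for j
    by (simp add: G_def a_def hprod_self)
  have Gcol: "sqnorm k (\<lambda>i. G i j) = a j" for j
    using sqnorm_stiefel[OF adj, of "\<lambda>h. P h j"]
    by (simp add: qmat_adj_def G_def a_def hprod_def)
  have E: "sqnorm k (E j) = 1 - a j" if "j < k" for j
  proof -
    have "(norm (E j i))\<^sup>2 = (norm (G i j))\<^sup>2 + (if i = j then 1 - 2 * a j else 0)" for i
    proof (cases "i = j")
      case True
      have "E j j = of_real (1 - a j)"
        by (simp add: E_def Gjj)
      then show ?thesis
        using True by (simp add: Gjj power2_eq_square algebra_simps del: of_real_diff)
    qed (simp add: E_def)
    then have "sqnorm k (E j) = sqnorm k (\<lambda>i. G i j) + (1 - 2 * a j)"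
      using that by (simp add: sqnorm_def sum.distrib)
    then show ?thesis
      by (simp add: Gcol)
  qed
  have "(\<Sum>j<k. a j) = real k"
  proof -
    have "sqnorm k (\<lambda>j. P h j) = 1" if "h < k" for h
    proof -
      have "hprod k (\<lambda>i. qmat_adj P i h) (\<lambda>i. qmat_adj P i h) = 1"
        using adj that by (simp add: stiefel_iff)
      then have "sqnorm k (\<lambda>i. qmat_adj P i h) = 1"
        by (simp add: hprod_self)
      then show ?thesis
        by (simp add: qmat_adj_def sqnorm_def)
    qed
    moreover have "(\<Sum>j<k. a j) = (\<Sum>h<k. sqnorm k (\<lambda>j. P h j))"
      unfolding a_def sqnorm_def by (rule sum.swap)
    ultimately show ?thesis
      by simp
  qed
  then have "(\<Sum>j<k. sqnorm k (E j)) = 0"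
    by (simp add: E sum_subtractf)
  then have "E j i = 0" if "i < k" "j < k" for i j
    using that by (simp add: sum_nonneg_eq_0_iff sqnorm_nonneg sqnorm_eq_0_iff)
  then have "G i j = (if i = j then 1 else 0)" if "i < k" "j < k" for i j
    using that unfolding E_def by (metis eq_iff_diff_eq_0)
  moreover have "P \<in> qmats k k"
    using assms by (simp add: Sp_def)
  ultimately show ?thesis
    by (simp add: stiefel_iff G_def)
qed

lemma stiefel_incl_in_stiefel:
  assumes "P \<in> stiefel k k" "k \<le> n"
  shows "stiefel_incl n k P \<in> stiefel n k"
proof -
  let ?y = "stiefel_incl n k P"
  obtain m where n: "n = m + k"
    using assms(2) by (metis add.commute le_Suc_ex)
  have "hprod n (\<lambda>i. ?y i h) (\<lambda>i. ?y i l) = hprod k (\<lambda>i. P i h) (\<lambda>i. P i l)" for h l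
  proof -
    have "(\<Sum>i<m + k'. qcnj (?y i h) * ?y i l) = (\<Sum>i<k'. qcnj (P i h) * P i l)" for k'
      by (induction k') (auto simp: stiefel_incl_def n)
    then show ?thesis
      by (simp add: hprod_def n)
  qed
  moreover have "?y \<in> qmats n k"
    using assms by (auto simp: stiefel_incl_def qmats_def stiefel_iff)
  ultimately show ?thesis
    using assms(1) by (simp add: stiefel_iff)
qed

text \<open>
  The standard frame with its last vector multiplied by \<open>e\<close>. The sign of \<open>e\<close> distinguishes the
  centres of the two sets that cover \<open>Sp(k)\<close>.
\<close>

definition base_frame :: "nat \<Rightarrow> real \<Rightarrow> qmat"
  where "base_frame k e = (\<lambda>i j. if i = j \<and> j < k then (if Suc j = k then of_real e else 1) else 0)"

lemma base_frame_in_stiefel: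
  assumes "k \<le> n" "\<bar>e\<bar> = 1"
  shows "base_frame k e \<in> stiefel n k"
proof -
  have e: "e = 1 \<or> e = - 1"
    using assms(2) by linarith
  have "hprod n (\<lambda>i. base_frame k e i h) (\<lambda>i. base_frame k e i l) = (if h = l then 1 else 0)"
    if "h < k" "l < k" for h l
  proof -
    have "hprod n (\<lambda>i. base_frame k e i h) (\<lambda>i. base_frame k e i l)
        = (\<Sum>i<n. if i = h then (if h = l then 1 else 0) else 0)"
      unfolding hprod_def using e that by (intro sum.cong) (auto simp: base_frame_def)
    then show ?thesis
      using that assms(1) by simp
  qed
  then show ?thesis
    using assms(1) by (auto simp: stiefel_iff qmats_def base_frame_def)
qed

text \<open>
  The dimension \<open>n = 2 k - 1\<close> makes the single row \<open>k - 1\<close> (counted from 0) of the \<open>n \<times> k\<close> matrices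
  the meeting point of the two blocks: it is the last row in which the base frame is nonzero and
  the first row of \<open>P\<close>. In the \<open>k - 1\<close> rows above it only the base frame contributes.
\<close>

lemma incl_in_cayley_domain:
  assumes P: "P \<in> stiefel k k" and n: "n = 2 * k - 1" "k > 0"
    and neq: "P 0 (k - 1) \<noteq> - of_real e"
  shows "stiefel_incl n k P \<in> cayley_domain n k (base_frame k e)"
proof -
  let ?y = "stiefel_incl n k P"
  have nk: "n - k = k - 1"
    using n by simp
  have "\<forall>l<k. c l = 0"
    if c: "\<forall>i<n. (\<Sum>l<k. (?y i l + base_frame k e i l) * c l) = 0" for c
  proof -
    have top: "c i = 0" if "i < k - 1" for i
    proof -
      have "(\<Sum>l<k. (?y i l + base_frame k e i l) * c l) = (\<Sum>l<k. if l = i then c l else 0)"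
        using that nk by (intro sum.cong) (auto simp: stiefel_incl_def base_frame_def)
      moreover have "i < n" "i < k"
        using that n by simp_all
      ultimately show ?thesis
        using c by simp
    qed
    \<comment> \<open>in row \<open>k - 1\<close> only the last coefficient is left\<close>
    have "(\<Sum>l<k. (?y (k - 1) l + base_frame k e (k - 1) l) * c l)
        = (\<Sum>l<k. if l = k - 1 then (P 0 (k - 1) + of_real e) * c l else 0)"
      using n nk top by (intro sum.cong) (auto simp: stiefel_incl_def base_frame_def)
    then have "(P 0 (k - 1) + of_real e) * c (k - 1) = 0"
      using c n by simp
    then have "c (k - 1) = 0"
      using neq by (simp add: eq_neg_iff_add_eq_0)
    with top show ?thesis
      by (metis Suc_pred' less_Suc_eq n(2))
  qed
  then show ?thesis
    using stiefel_incl_in_stiefel[OF P, of n] n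
    by (auto simp: cayley_domain_def inj_cols_def)
qed

theorem proposition5p2:
  fixes k n :: nat
  assumes "k > 0" and "n = 2 * k - 1"
  shows "subspace_cat (top_of_set (stiefel n k)) (stiefel_incl n k ` Sp k) \<le> 1"
proof -
  define U where "U = (\<lambda>i :: nat. cayley_domain n k (base_frame k (if i = 0 then 1 else - 1)))"
  let ?X = "top_of_set (stiefel n k)"
  have "openin ?X (U i) \<and> contractible_within ?X (U i)" for i
    unfolding U_def using assms
    by (intro conjI openin_cayley_domain contractible_cayley_domain base_frame_in_stiefel) auto
  moreover have "stiefel_incl n k P \<in> U 0 \<union> U 1" if "P \<in> Sp k" for P
  proof -
    have "(1 :: quat) \<noteq> - 1"
      by (simp add: quat_ring_defs)
    then have "P 0 (k - 1) \<noteq> - of_real 1 \<or> P 0 (k - 1) \<noteq> - of_real (- 1)"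
      by auto
    then show ?thesis
      using incl_in_cayley_domain[OF Sp_in_stiefel[OF that] assms(2,1)]
      unfolding U_def by (metis Un_iff one_neq_zero)
  qed
  then have "stiefel_incl n k ` Sp k \<subseteq> (\<Union>i\<le>1. U i)"
    by (auto simp: atMost_Suc)
  ultimately show ?thesis
    unfolding subspace_cat_def one_enat_def by (intro Inf_lower) blast
qed

end
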